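(* Let $x>0$ and $\beta\ge 0$ be given, let $z_{m,m^\circ}(\cdot)$ be the tail functions, and let the critical values $\mathfrak z_{m,m^\circ}=z_{m,m^\circ}(x+q_{m^\circ})+\beta\sqrt{\mathsf p_{m,m^\circ}}$ be defined with the multiplicity corrections $q_{m^\circ}=q_{m^\circ}(x)$, as described in the context. Then the SmA selector $\hat m$ satisfies the propagation property $$\mathbb P(m^*\text{ is rejected})\le e^{-x}.$$ Moreover, for any subset $\mathcal M^{c}\subseteq \mathcal M^-(m^* )$ such that $$\|b_{m^*,m}\|>\mathfrak z_{m^*,m}+z_{m^*,m}(x_s)\quad\text{for all } m\in\mathcal M^{c},\qquad x_s:=x+\log(|\mathcal M^{c}|),$$ it holds $$\mathbb P(\hat m\in\mathcal M^{c})\le e^{-x}.$$ The SmA estimator $\hat\phi=\tilde\phi_{\hat m}$ satisfies $$\mathbb P\bigl(\|\hat\phi-\tilde\phi_{m^*}\|>\bar{\mathfrak z}_{m^*}\bigr)\le 2e^{-x},\qquad \bar{\mathfrak z}_{m^*}:=\max_{m\in\mathcal M^{\circ}}\mathfrak z_{m^*,m},\quad \mathcal M^{\circ}:=\mathcal M^-(m^* )\setminus\mathcal M^{c}.$$ This implies the probabilistic oracle bound: with probability at least $1-2e^{-x}$, $$\|\hat\phi-\phi^*\|\le\|\tilde\phi_{m^*}-\phi^*\|+\bar{\mathfrak z}_{m^*}.$$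
   Context: Model: $Y=f^*+\varepsilon\in\mathbb R^n$, where $f^*=\mathbb E Y$ is deterministic and $\varepsilon$ has independent zero-mean components with known distribution and finite covariance matrix $\mathrm{Var}(\varepsilon)$. $\|\cdot\|$ is the Euclidean norm. The target is $\phi^*=\mathcal K f^*\in\mathbb R^q$ for a given $q\times n$ matrix $\mathcal K$. $\mathcal M$ is a finite set of positive numbers (models), and for each $m\in\mathcal M$ a $q\times n$ matrix $\mathcal K_m$ is given, defining the linear estimator $\tilde\phi_m=\mathcal K_mY$. (In the underlying regression notation, $\mathcal K=W\mathcal S$ with $\mathcal S=(\Psi\Psi^\top)^{-1}\Psi$, and $\mathcal K_m=W\mathcal S_m$, for a design matrix $\Psi\in\mathbb R^{p\times n}$, a weighting matrix $W\in\mathbb R^{q\times p}$ and given $\mathcal S_m\in\mathbb R^{p\times n}$.) The family is ordered: $\mathcal K_m\mathrm{Var}(\varepsilon)\mathcal K_m^\top\le\mathcal K_{m'}\mathrm{Var}(\varepsilon)\mathcal K_{m'}^\top$ for $m'>m$ in $\mathcal M$. For $m>m^\circ$ in $\mathcal M$ put $\mathcal K_{m,m^\circ}=\mathcal K_m-\mathcal K_{m^\circ}$, $b_{m,m^\circ}=\mathcal K_{m,m^\circ}f^*$, $\xi_{m,m^\circ}=\mathcal K_{m,m^\circ}\varepsilon$, $\mathbb V_{m,m^\circ}=\mathrm{Var}(\xi_{m,m^\circ})$, $\mathsf p_{m,m^\circ}=\mathrm{tr}(\mathbb V_{m,m^\circ})=\mathbb E\|\xi_{m,m^\circ}\|^2$,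 and $\mathbb T_{m,m^\circ}=\|\tilde\phi_m-\tilde\phi_{m^\circ}\|=\|b_{m,m^\circ}+\xi_{m,m^\circ}\|$. Let $\mathcal M^+(m^\circ)=\{m\in\mathcal M:m>m^\circ\}$ and $\mathcal M^-(m^\circ)=\{m\in\mathcal M:m<m^\circ\}$. Oracle: $m^*$ is the smallest $m^\circ\in\mathcal M$ such that $\|b_{m,m^\circ}\|^2\le\beta^2\mathsf p_{m,m^\circ}$ for all $m\in\mathcal M^+(m^\circ)$. Tail function: $z_{m,m^\circ}(t)$ satisfies $\mathbb P(\|\xi_{m,m^\circ}\|>z_{m,m^\circ}(t))=e^{-t}$; the distribution of $\|\xi_{m,m^\circ}\|$ is assumed continuous (otherwise $z_{m,m^\circ}(t)$ is the smallest value for which this probability is at most $e^{-t}$). Multiplicity correction: $q_{m^\circ}=q_{m^\circ}(x)$ is defined (when $\mathcal M^+(m^\circ)\neq\emptyset$) by $\mathbb P\bigl(\bigcup_{m\in\mathcal M^+(m^\circ)}\{\|\xi_{m,m^\circ}\|\ge z_{m,m^\circ}(x+q_{m^\circ})\}\bigr)=e^{-x}$. Acceptance: a model $m^\circ$ is accepted if $\mathbb T_{m,m^\circ}\le\mathfrak z_{m,m^\circ}$ for all $m\in\mathcal M^+(m^\circ)$, otherwise it is rejected. The SmA ("smallest accepted") selector $\hat m$ is the smallest accepted $m^\circ\in\mathcal M$. Maxima over empty sets are taken to be $0$, and for $\mathcal M^c=\emptyset$ the condition on $\mathcal M^c$ is void. *)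

theory Defs
  imports "HOL-Probability.Probability"
begin

definition covariance_matrix :: "'w measure \<Rightarrow> ('w \<Rightarrow> real ^ 'n) \<Rightarrow> real ^ 'n ^ 'n" where
  "covariance_matrix \<Omega> X =
     (\<chi> i j. \<integral>\<omega>. (X \<omega> $ i - (\<integral>\<omega>'. X \<omega>' $ i \<partial>\<Omega>)) * (X \<omega> $ j - (\<integral>\<omega>'. X \<omega>' $ j \<partial>\<Omega>)) \<partial>\<Omega>)"

text \<open>Only applied to symmetric matrices (covariances), so symmetry of \<open>B - A\<close> is not demanded.\<close>

definition loewner_le :: "real ^ 'n ^ 'n \<Rightarrow> real ^ 'n ^ 'n \<Rightarrow> bool" where
  "loewner_le A B \<longleftrightarrow> (\<forall>v. 0 \<le> v \<bullet> ((B - A) *v v))"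

definition models_above :: "real set \<Rightarrow> real \<Rightarrow> real set" where
  "models_above \<M> m0 = {m \<in> \<M>. m > m0}"

definition models_below :: "real set \<Rightarrow> real \<Rightarrow> real set" where
  "models_below \<M> m0 = {m \<in> \<M>. m < m0}"

definition bias_diff :: "(real \<Rightarrow> real ^ 'n ^ 'q) \<Rightarrow> real ^ 'n \<Rightarrow> real \<Rightarrow> real \<Rightarrow> real ^ 'q" where
  "bias_diff \<K> f m m0 = (\<K> m - \<K> m0) *v f"

definition noise_diff :: "(real \<Rightarrow> real ^ 'n ^ 'q) \<Rightarrow> ('w \<Rightarrow> real ^ 'n) \<Rightarrow> real \<Rightarrow> real \<Rightarrow> 'w \<Rightarrow> real ^ 'q" where
  "noise_diff \<K> \<epsilon> m m0 \<omega> = (\<K> m - \<K> m0) *v \<epsilon> \<omega>"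

definition noise_power :: "'w measure \<Rightarrow> (real \<Rightarrow> real ^ 'n ^ 'q) \<Rightarrow> ('w \<Rightarrow> real ^ 'n) \<Rightarrow> real \<Rightarrow> real \<Rightarrow> real" where
  "noise_power \<Omega> \<K> \<epsilon> m m0 = trace (covariance_matrix \<Omega> (noise_diff \<K> \<epsilon> m m0))"

definition oracle_model :: "real set \<Rightarrow> real \<Rightarrow> (real \<Rightarrow> real \<Rightarrow> real ^ 'q) \<Rightarrow> (real \<Rightarrow> real \<Rightarrow> real) \<Rightarrow> real" where
  "oracle_model \<M> \<beta> b p =
     Min {m0 \<in> \<M>. \<forall>m \<in> models_above \<M> m0. (norm (b m m0))\<^sup>2 \<le> \<beta>\<^sup>2 * p m m0}"

text \<open>
  The arguments are restricted to \<open>t > 0\<close>, since \<open>exp (- t)\<close> must be below 1 for the defining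
  relation to determine a (nonnegative) quantile. For a continuous distribution any solution of the
  equation is admitted; it need not be unique if the distribution function has flat pieces.
\<close>

definition tail_function :: "'w measure \<Rightarrow> ('w \<Rightarrow> real) \<Rightarrow> (real \<Rightarrow> real) \<Rightarrow> bool" where
  "tail_function \<Omega> X z \<longleftrightarrow>
     (\<forall>t>0.
        if continuous_on UNIV (cdf (distr \<Omega> borel X))
        then \<P>(\<omega> in \<Omega>. X \<omega> > z t) = exp (- t)
        else \<P>(\<omega> in \<Omega>. X \<omega> > z t) \<le> exp (- t) \<and>
             (\<forall>u. \<P>(\<omega> in \<Omega>. X \<omega> > u) \<le> exp (- t) \<longrightarrow> z t \<le> u))"

text \<open>
  \<open>c\<close> is a multiplicity correction at \<open>m0\<close> for the level \<open>x\<close>; \<open>0 < x + c\<close> says that the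
  tail functions are evaluated inside their domain.
\<close>

definition multiplicity_correction ::
    "'w measure \<Rightarrow> real set \<Rightarrow> (real \<Rightarrow> real \<Rightarrow> 'w \<Rightarrow> real ^ 'q) \<Rightarrow> (real \<Rightarrow> real \<Rightarrow> real \<Rightarrow> real)
       \<Rightarrow> real \<Rightarrow> real \<Rightarrow> real \<Rightarrow> bool" where
  "multiplicity_correction \<Omega> \<M> \<xi> z x m0 c \<longleftrightarrow>
     0 < x + c \<and>
     \<P>(\<omega> in \<Omega>. \<exists>m \<in> models_above \<M> m0. norm (\<xi> m m0 \<omega>) \<ge> z m m0 (x + c)) = exp (- x)"

definition critical_value ::
    "(real \<Rightarrow> real \<Rightarrow> real \<Rightarrow> real) \<Rightarrow> (real \<Rightarrow> real) \<Rightarrow> (real \<Rightarrow> real \<Rightarrow> real)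
       \<Rightarrow> real \<Rightarrow> real \<Rightarrow> real \<Rightarrow> real \<Rightarrow> real" where
  "critical_value z q p x \<beta> m m0 = z m m0 (x + q m0) + \<beta> * sqrt (p m m0)"

definition accepted ::
    "real set \<Rightarrow> (real \<Rightarrow> real ^ 'q) \<Rightarrow> (real \<Rightarrow> real \<Rightarrow> real) \<Rightarrow> real \<Rightarrow> bool" where
  "accepted \<M> \<phi> \<zz> m0 \<longleftrightarrow> (\<forall>m \<in> models_above \<M> m0. norm (\<phi> m - \<phi> m0) \<le> \<zz> m m0)"

definition sma_selector ::
    "real set \<Rightarrow> (real \<Rightarrow> real ^ 'q) \<Rightarrow> (real \<Rightarrow> real \<Rightarrow> real) \<Rightarrow> real" where
  "sma_selector \<M> \<phi> \<zz> = Min {m0 \<in> \<M>. accepted \<M> \<phi> \<zz> m0}"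

definition max_or_zero :: "real set \<Rightarrow> real" where
  "max_or_zero A = (if A = {} then 0 else Max A)"

end

theory Submission
  imports Defs
begin

text \<open>
  The theorem holds because both ways in which the selector can go wrong force a noise norm above
  a quantile. Every difference of two estimators splits into a deterministic bias and a noise term
  (\<open>estimator_diff\<close>).

  \<^item> If the oracle \<open>m\<^sup>*\<close> is rejected in favour of some larger \<open>m\<close>, the bias uses up at most the part
  \<open>\<beta> * sqrt p\<close> of the critical value, by the very definition of the oracle
  (\<open>oracle_model_bias_le\<close>). Hence the noise alone exceeds its quantile \<open>z m m\<^sup>* (x + q m\<^sup>*)\<close>, and the
  multiplicity correction is chosen so that this happens for some \<open>m\<close> with probability at most
  \<open>exp (- x)\<close> (\<open>prob_oracle_rejected\<close>).

  \<^item> If a model \<open>m\<close> of the strongly biased set \<open>Mc\<close> is selected, then it is accepted; in particular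
  its comparison with \<open>m\<^sup>*\<close> stays below the critical value, so the noise must compensate the excess
  of the bias and is larger than the quantile at level \<open>x + ln (card Mc)\<close>. The logarithm pays for
  the union bound over \<open>Mc\<close> (\<open>prob_biased_accepted\<close>).

  Outside these two events the selected model is the oracle itself or a smaller accepted model
  outside \<open>Mc\<close>, and acceptance bounds the distance to the oracle estimator by a critical value
  (\<open>selected_close_to_oracle\<close>). The case of the oracle itself uses that critical values are
  nonnegative (\<open>critical_value_nonneg\<close>). The oracle bound is then the triangle inequality; as it
  is a lower bound for a probability, its event has to be measurable, which holds since the selector
  takes finitely many values, each on a measurable event (\<open>measurable_sma_selector\<close>).
\<close>

section \<open>Quantiles and critical values\<close>

lemma noise_power_nonneg: "0 \<le> noise_power \<Omega> \<K> \<epsilon> m m0"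
  unfolding noise_power_def trace_def covariance_matrix_def
  by (auto intro!: sum_nonneg integral_nonneg)

text \<open>
  An atom can make the exact level \<open>exp (- t)\<close> unattainable; the error probabilities only have to be
  bounded from above, so this inequality treats both branches of the definition alike.
\<close>

lemma tail_function_le:
  assumes "tail_function \<Omega> X z" "0 < t"
  shows "\<P>(\<omega> in \<Omega>. X \<omega> > z t) \<le> exp (- t)"
  using assms unfolding tail_function_def by (auto split: if_splits)

text \<open>
  A nonnegative variable always exceeds a negative number, which is incompatible with a
  level \<open>exp (- t) < 1\<close>.
\<close>

lemma tail_function_nonneg:
  assumes "prob_space \<Omega>" "tail_function \<Omega> X z" "0 < t" "\<And>\<omega>. 0 \<le> X \<omega>"
  shows "0 \<le> z t"
proof (rule ccontr)
  interpret prob_space \<Omega> by fact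
  assume "\<not> 0 \<le> z t"
  then have "X \<omega> > z t" for \<omega>
    using assms(4)[of \<omega>] by linarith
  then have "\<P>(\<omega> in \<Omega>. X \<omega> > z t) = 1"
    by (simp add: prob_space)
  then have "1 \<le> exp (- t)"
    using tail_function_le[OF assms(2,3)] by simp
  with \<open>0 < t\<close> show False
    by simp
qed

lemma critical_value_nonneg:
  assumes "prob_space \<Omega>" "0 \<le> \<beta>" "m \<in> models_above \<M> m0"
    and "tail_function \<Omega> (\<lambda>\<omega>. norm (noise_diff \<K> \<epsilon> m m0 \<omega>)) (z m m0)"
    and "multiplicity_correction \<Omega> \<M> (noise_diff \<K> \<epsilon>) z x m0 (q m0)"
  shows "0 \<le> critical_value z q (noise_power \<Omega> \<K> \<epsilon>) x \<beta> m m0"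
proof -
  have "0 < x + q m0"
    using assms(5) by (simp add: multiplicity_correction_def)
  with assms(1,4) have "0 \<le> z m m0 (x + q m0)"
    by (rule tail_function_nonneg) simp
  then show ?thesis
    by (simp add: critical_value_def assms(2) noise_power_nonneg)
qed

section \<open>The oracle and the selector\<close>

lemma estimator_diff:
  "\<K> m *v (f + \<epsilon> \<omega>) - \<K> m0 *v (f + \<epsilon> \<omega>) = bias_diff \<K> f m m0 + noise_diff \<K> \<epsilon> m m0 \<omega>"
  by (simp add: bias_diff_def noise_diff_def algebra_simps matrix_vector_mult_diff_rdistrib)

text \<open>
  Both minima, the oracle and the selector, range over a nonempty set for the same reason: their
  condition at \<open>m0\<close> only concerns larger models, so it is void at the largest model.
\<close>

lemma models_above_Max:
  assumes "finite \<M>"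
  shows "models_above \<M> (Max \<M>) = {}"
  using Max_ge[OF assms] by (fastforce simp: models_above_def)

lemma oracle_model_mem:
  assumes "finite \<M>" "\<M> \<noteq> {}"
  shows "oracle_model \<M> \<beta> b p
    \<in> {m0 \<in> \<M>. \<forall>m \<in> models_above \<M> m0. (norm (b m m0))\<^sup>2 \<le> \<beta>\<^sup>2 * p m m0}"
  unfolding oracle_model_def
proof (rule Min_in)
  show "{m0 \<in> \<M>. \<forall>m \<in> models_above \<M> m0. (norm (b m m0))\<^sup>2 \<le> \<beta>\<^sup>2 * p m m0} \<noteq> {}"
    using Max_in[OF assms] models_above_Max[OF assms(1)] by blast
qed (use assms in simp)

lemma oracle_model_bias_le:
  assumes "finite \<M>" "\<M> \<noteq> {}" "0 \<le> \<beta>" "m \<in> models_above \<M> (oracle_model \<M> \<beta> b p)"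
  shows "norm (b m (oracle_model \<M> \<beta> b p)) \<le> \<beta> * sqrt (p m (oracle_model \<M> \<beta> b p))"
proof -
  have "(norm (b m (oracle_model \<M> \<beta> b p)))\<^sup>2 \<le> \<beta>\<^sup>2 * p m (oracle_model \<M> \<beta> b p)"
    using oracle_model_mem[OF assms(1,2), of \<beta> b p] assms(4) by blast
  from real_sqrt_le_mono[OF this] show ?thesis
    using assms(3) by (simp add: real_sqrt_mult)
qed

lemma sma_selector_mem:
  assumes "finite \<M>" "\<M> \<noteq> {}"
  shows "sma_selector \<M> \<phi> \<zz> \<in> {m0 \<in> \<M>. accepted \<M> \<phi> \<zz> m0}"
  unfolding sma_selector_def
proof (rule Min_in)
  show "{m0 \<in> \<M>. accepted \<M> \<phi> \<zz> m0} \<noteq> {}"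
    using Max_in[OF assms] models_above_Max[OF assms(1)] by (auto simp: accepted_def)
qed (use assms in simp)

lemma sma_selector_le:
  assumes "finite \<M>" "m \<in> \<M>" "accepted \<M> \<phi> \<zz> m"
  shows "sma_selector \<M> \<phi> \<zz> \<le> m"
  unfolding sma_selector_def using assms by (intro Min_le) auto

lemma sma_selector_eq_iff:
  assumes "finite \<M>" "\<M> \<noteq> {}"
  shows "sma_selector \<M> \<phi> \<zz> = m \<longleftrightarrow>
    m \<in> \<M> \<and> accepted \<M> \<phi> \<zz> m \<and> (\<forall>m' \<in> models_below \<M> m. \<not> accepted \<M> \<phi> \<zz> m')"
proof
  assume "sma_selector \<M> \<phi> \<zz> = m"
  then show "m \<in> \<M> \<and> accepted \<M> \<phi> \<zz> m \<and> (\<forall>m' \<in> models_below \<M> m. \<not> accepted \<M> \<phi> \<zz> m')"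
    using sma_selector_mem[OF assms, of \<phi> \<zz>] sma_selector_le[OF assms(1), of _ \<phi> \<zz>]
    by (fastforce simp: models_below_def)
next
  assume "m \<in> \<M> \<and> accepted \<M> \<phi> \<zz> m \<and> (\<forall>m' \<in> models_below \<M> m. \<not> accepted \<M> \<phi> \<zz> m')"
  then show "sma_selector \<M> \<phi> \<zz> = m"
    using sma_selector_mem[OF assms, of \<phi> \<zz>] sma_selector_le[OF assms(1), of m \<phi> \<zz>]
    by (fastforce simp: models_below_def)
qed

text \<open>
  If an accepted reference model \<open>m1\<close> differs from the selected model, the selected model is
  smaller and has itself passed the comparison with \<open>m1\<close>.
\<close>

lemma selected_close_to_oracle:
  assumes "finite \<M>" "\<M> \<noteq> {}" "m1 \<in> \<M>"
    and acc: "accepted \<M> \<phi> \<zz> m1"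
    and notin: "sma_selector \<M> \<phi> \<zz> \<notin> Mc"
    and nonneg: "\<And>m. m \<in> models_below \<M> m1 \<Longrightarrow> 0 \<le> \<zz> m1 m"
  shows "norm (\<phi> (sma_selector \<M> \<phi> \<zz>) - \<phi> m1)
    \<le> max_or_zero (\<zz> m1 ` (models_below \<M> m1 - Mc))"
proof -
  define s where "s = sma_selector \<M> \<phi> \<zz>"
  define A where "A = \<zz> m1 ` (models_below \<M> m1 - Mc)"
  have s: "s \<in> \<M>" "accepted \<M> \<phi> \<zz> s" "s \<le> m1"
    using sma_selector_mem[OF assms(1,2), of \<phi> \<zz>] sma_selector_le[OF assms(1,3) acc]
    by (simp_all add: s_def)
  have fin: "finite A"
    using assms(1) by (simp add: A_def models_below_def)
  show ?thesis
  proof (cases "s = m1")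
    case True
    have "0 \<le> max_or_zero A"
    proof (cases "A = {}")
      case False
      then have "Max A \<in> A"
        using fin by simp
      moreover have "0 \<le> a" if "a \<in> A" for a
        using that nonneg by (auto simp: A_def)
      ultimately have "0 \<le> Max A"
        by blast
      with False show ?thesis
        by (simp add: max_or_zero_def)
    qed (simp add: max_or_zero_def)
    then show ?thesis
      using True by (simp add: A_def s_def)
  next
    case False
    then have "m1 \<in> models_above \<M> s" "\<zz> m1 s \<in> A"
      using s notin assms(3) by (auto simp: models_above_def models_below_def A_def s_def)
    then have "norm (\<phi> m1 - \<phi> s) \<le> \<zz> m1 s" "\<zz> m1 s \<le> max_or_zero A"
      using s fin by (auto simp: accepted_def max_or_zero_def)
    then show ?thesis
      by (simp add: norm_minus_commute A_def s_def)
  qed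
qed

section \<open>Measurability\<close>

lemma borel_measurable_matrix_vector_mult [measurable (raw)]:
  fixes A :: "real ^ 'n ^ 'q"
  assumes [measurable]: "X \<in> borel_measurable M"
  shows "(\<lambda>\<omega>. A *v X \<omega>) \<in> borel_measurable M"
proof -
  have "(\<lambda>v. A *v v) \<in> borel_measurable borel"
    by (intro borel_measurable_continuous_onI linear_continuous_on matrix_vector_mul_bounded_linear)
  then show ?thesis
    by measurable
qed

lemma borel_measurable_vec_components:
  fixes X :: "'w \<Rightarrow> real ^ 'n"
  assumes "\<And>i. (\<lambda>\<omega>. X \<omega> $ i) \<in> borel_measurable M"
  shows "X \<in> borel_measurable M"
  using assms
  by (subst borel_measurable_euclidean_space) (auto simp: Basis_vec_def inner_axis)

lemma measurable_accepted:
  assumes "finite \<M>" and [measurable]: "\<And>m. (\<lambda>\<omega>. \<phi> \<omega> m) \<in> borel_measurable M"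
  shows "Measurable.pred M (\<lambda>\<omega>. accepted \<M> (\<phi> \<omega>) \<zz> m0)"
proof -
  have "finite (models_above \<M> m0)"
    using assms(1) by (simp add: models_above_def)
  then show ?thesis
    unfolding accepted_def by measurable
qed

lemma measurable_sma_selector:
  assumes "finite \<M>" "\<M> \<noteq> {}" "\<And>m. (\<lambda>\<omega>. \<phi> \<omega> m) \<in> borel_measurable M"
  shows "Measurable.pred M (\<lambda>\<omega>. sma_selector \<M> (\<phi> \<omega>) \<zz> = m)"
proof -
  have [measurable]: "Measurable.pred M (\<lambda>\<omega>. accepted \<M> (\<phi> \<omega>) \<zz> m')" for m'
    using assms(1,3) by (rule measurable_accepted)
  have "finite (models_below \<M> m)"
    using assms(1) by (simp add: models_below_def)
  then show ?thesis
    unfolding sma_selector_eq_iff[OF assms(1,2)] by measurable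
qed

text \<open>
  The selector has finitely many values, so inserting it into \<open>P\<close> amounts to a finite case
  distinction over measurable events.
\<close>

lemma measurable_pred_sma_selector:
  assumes "finite \<M>" "\<M> \<noteq> {}" "\<And>m. (\<lambda>\<omega>. \<phi> \<omega> m) \<in> borel_measurable M"
    and [measurable]: "\<And>m. Measurable.pred M (\<lambda>\<omega>. P \<omega> m)"
  shows "Measurable.pred M (\<lambda>\<omega>. P \<omega> (sma_selector \<M> (\<phi> \<omega>) \<zz>))"
proof -
  have [measurable]: "Measurable.pred M (\<lambda>\<omega>. sma_selector \<M> (\<phi> \<omega>) \<zz> = m)" for m
    using assms(1,2,3) by (rule measurable_sma_selector)
  have "P \<omega> (sma_selector \<M> (\<phi> \<omega>) \<zz>) \<longleftrightarrow> (\<exists>m \<in> \<M>. sma_selector \<M> (\<phi> \<omega>) \<zz> = m \<and> P \<omega> m)" for \<omega>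
    using sma_selector_mem[OF assms(1,2), of "\<phi> \<omega>" \<zz>] by auto
  moreover have "Measurable.pred M (\<lambda>\<omega>. \<exists>m \<in> \<M>. sma_selector \<M> (\<phi> \<omega>) \<zz> = m \<and> P \<omega> m)"
    using assms(1) by measurable
  ultimately show ?thesis
    by simp
qed

section \<open>The two error events\<close>

text \<open>
  The bias part of the critical value absorbs the bias of the comparison, so a rejection is caused
  by the noise alone, and the joint level of these noise events is the one that the multiplicity
  correction prescribes.
\<close>

lemma prob_oracle_rejected:
  assumes "prob_space \<Omega>" and [measurable]: "\<epsilon> \<in> borel_measurable \<Omega>"
    and "finite \<M>"
    and bias: "\<And>m. m \<in> models_above \<M> m1 \<Longrightarrow>
      norm (bias_diff \<K> f m m1) \<le> \<beta> * sqrt (p m m1)"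
    and mult: "models_above \<M> m1 \<noteq> {} \<Longrightarrow>
      multiplicity_correction \<Omega> \<M> (noise_diff \<K> \<epsilon>) z x m1 (q m1)"
  shows "\<P>(\<omega> in \<Omega>. \<not> accepted \<M> (\<lambda>m. \<K> m *v (f + \<epsilon> \<omega>)) (critical_value z q p x \<beta>) m1) \<le> exp (- x)"
proof (cases "models_above \<M> m1 = {}")
  case True
  then show ?thesis
    by (simp add: accepted_def)
next
  case False
  interpret prob_space \<Omega> by fact
  have fin: "finite (models_above \<M> m1)"
    using assms(3) by (simp add: models_above_def)
  have "\<P>(\<omega> in \<Omega>. \<not> accepted \<M> (\<lambda>m. \<K> m *v (f + \<epsilon> \<omega>)) (critical_value z q p x \<beta>) m1)
    \<le> \<P>(\<omega> in \<Omega>. \<exists>m \<in> models_above \<M> m1. norm (noise_diff \<K> \<epsilon> m m1 \<omega>) \<ge> z m m1 (x + q m1))"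
  proof (rule finite_measure_mono)
    show "{\<omega> \<in> space \<Omega>. \<exists>m \<in> models_above \<M> m1. norm (noise_diff \<K> \<epsilon> m m1 \<omega>) \<ge> z m m1 (x + q m1)}
      \<in> sets \<Omega>"
      unfolding noise_diff_def using fin by measurable
    show "{\<omega> \<in> space \<Omega>. \<not> accepted \<M> (\<lambda>m. \<K> m *v (f + \<epsilon> \<omega>)) (critical_value z q p x \<beta>) m1}
      \<subseteq> {\<omega> \<in> space \<Omega>. \<exists>m \<in> models_above \<M> m1. norm (noise_diff \<K> \<epsilon> m m1 \<omega>) \<ge> z m m1 (x + q m1)}"
    proof clarsimp
      fix \<omega>
      assume "\<not> accepted \<M> (\<lambda>m. \<K> m *v (f + \<epsilon> \<omega>)) (critical_value z q p x \<beta>) m1"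
      then obtain m where m: "m \<in> models_above \<M> m1"
        and "norm (bias_diff \<K> f m m1 + noise_diff \<K> \<epsilon> m m1 \<omega>) > z m m1 (x + q m1) + \<beta> * sqrt (p m m1)"
        unfolding accepted_def estimator_diff critical_value_def by force
      then have "z m m1 (x + q m1) \<le> norm (noise_diff \<K> \<epsilon> m m1 \<omega>)"
        using bias[OF m] norm_triangle_ineq[of "bias_diff \<K> f m m1" "noise_diff \<K> \<epsilon> m m1 \<omega>"]
        by linarith
      with m show "\<exists>m \<in> models_above \<M> m1. z m m1 (x + q m1) \<le> norm (noise_diff \<K> \<epsilon> m m1 \<omega>)" ..
    qed
  qed
  also have "\<dots> = exp (- x)"
    using mult[OF False] by (simp add: multiplicity_correction_def)
  finally show ?thesis .
qed

text \<open>
  Acceptance of \<open>m \<in> Mc\<close> requires noise of norm at least \<open>norm (b m1 m) - \<zz> m1 m\<close> in the comparison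
  with \<open>m1\<close>. Each of these events has probability at most \<open>exp (- x) / card Mc\<close>.
\<close>

lemma prob_biased_accepted:
  assumes "prob_space \<Omega>" and [measurable]: "\<epsilon> \<in> borel_measurable \<Omega>"
    and "finite Mc" "0 < x"
    and above: "\<And>m. m \<in> Mc \<Longrightarrow> m1 \<in> models_above \<M> m"
    and tail: "\<And>m. m \<in> Mc \<Longrightarrow>
      tail_function \<Omega> (\<lambda>\<omega>. norm (noise_diff \<K> \<epsilon> m1 m \<omega>)) (z m1 m)"
    and bias: "\<And>m. m \<in> Mc \<Longrightarrow>
      norm (bias_diff \<K> f m1 m) > \<zz> m1 m + z m1 m (x + ln (real (card Mc)))"
  shows "\<P>(\<omega> in \<Omega>. \<exists>m \<in> Mc. accepted \<M> (\<lambda>m. \<K> m *v (f + \<epsilon> \<omega>)) \<zz> m) \<le> exp (- x)"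
proof (cases "Mc = {}")
  case True
  then show ?thesis
    by simp
next
  case False
  interpret prob_space \<Omega> by fact
  define t where "t = x + ln (real (card Mc))"
  define E where "E = (\<lambda>m. {\<omega> \<in> space \<Omega>. norm (noise_diff \<K> \<epsilon> m1 m \<omega>) > z m1 m t})"
  have card: "0 < card Mc"
    using False assms(3) by (simp add: card_gt_0_iff)
  then have "0 < t"
    using assms(4) by (simp add: t_def add_pos_nonneg)
  have [measurable]: "E m \<in> sets \<Omega>" for m
    unfolding E_def noise_diff_def by measurable
  have "{\<omega> \<in> space \<Omega>. \<exists>m \<in> Mc. accepted \<M> (\<lambda>m. \<K> m *v (f + \<epsilon> \<omega>)) \<zz> m} \<subseteq> (\<Union>m \<in> Mc. E m)"
  proof clarsimp
    fix \<omega> m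
    assume \<omega>: "\<omega> \<in> space \<Omega>" and m: "m \<in> Mc"
      and "accepted \<M> (\<lambda>m. \<K> m *v (f + \<epsilon> \<omega>)) \<zz> m"
    then have "norm (bias_diff \<K> f m1 m + noise_diff \<K> \<epsilon> m1 m \<omega>) \<le> \<zz> m1 m"
      unfolding accepted_def estimator_diff using above[OF m] by blast
    then have "norm (noise_diff \<K> \<epsilon> m1 m \<omega>) > z m1 m t"
      using bias[OF m] norm_diff_ineq[of "bias_diff \<K> f m1 m" "noise_diff \<K> \<epsilon> m1 m \<omega>"]
      unfolding t_def by linarith
    with \<omega> m show "\<exists>m \<in> Mc. \<omega> \<in> E m"
      by (auto simp: E_def)
  qed
  then have "\<P>(\<omega> in \<Omega>. \<exists>m \<in> Mc. accepted \<M> (\<lambda>m. \<K> m *v (f + \<epsilon> \<omega>)) \<zz> m) \<le> prob (\<Union>m \<in> Mc. E m)"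
    using assms(3) by (intro finite_measure_mono) auto
  also have "\<dots> \<le> (\<Sum>m \<in> Mc. prob (E m))"
    using assms(3) by (intro finite_measure_subadditive_finite) auto
  also have "\<dots> \<le> (\<Sum>m \<in> Mc. exp (- t))"
    unfolding E_def using tail_function_le[OF tail \<open>0 < t\<close>] by (intro sum_mono) auto
  also have "\<dots> = exp (- x)"
    using card by (simp add: t_def exp_diff flip: diff_conv_add_uminus)
  finally show ?thesis .
qed

section \<open>Propagation and the oracle bound\<close>

theorem theorem2p1:
  fixes \<Omega> :: "'w measure"
    and \<epsilon> :: "'w \<Rightarrow> real ^ 'n"
    and f :: "real ^ 'n"
    and K :: "real ^ 'n ^ 'q"
    and \<M> :: "real set"
    and \<K> :: "real \<Rightarrow> real ^ 'n ^ 'q"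
    and z :: "real \<Rightarrow> real \<Rightarrow> real \<Rightarrow> real"
    and q :: "real \<Rightarrow> real"
    and x \<beta> :: real
  assumes prob: "prob_space \<Omega>"
    and indep: "prob_space.indep_vars \<Omega> (\<lambda>_. borel) (\<lambda>i \<omega>. \<epsilon> \<omega> $ i) UNIV"
    and zero_mean: "\<And>i. (\<integral>\<omega>. \<epsilon> \<omega> $ i \<partial>\<Omega>) = 0"
    and finite_var: "\<And>i. integrable \<Omega> (\<lambda>\<omega>. (\<epsilon> \<omega> $ i)\<^sup>2)"
    and models: "finite \<M>" "\<M> \<noteq> {}" "\<And>m. m \<in> \<M> \<Longrightarrow> 0 < m"
    and ordered: "\<And>m m'. m \<in> \<M> \<Longrightarrow> m' \<in> \<M> \<Longrightarrow> m < m' \<Longrightarrow>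
      loewner_le (\<K> m ** covariance_matrix \<Omega> \<epsilon> ** transpose (\<K> m))
                 (\<K> m' ** covariance_matrix \<Omega> \<epsilon> ** transpose (\<K> m'))"
    and x_pos: "0 < x"
    and beta_nonneg: "0 \<le> \<beta>"
    and tail: "\<And>m m0. m0 \<in> \<M> \<Longrightarrow> m \<in> models_above \<M> m0 \<Longrightarrow>
      tail_function \<Omega> (\<lambda>\<omega>. norm (noise_diff \<K> \<epsilon> m m0 \<omega>)) (z m m0)"
    and mult: "\<And>m0. m0 \<in> \<M> \<Longrightarrow> models_above \<M> m0 \<noteq> {} \<Longrightarrow>
      multiplicity_correction \<Omega> \<M> (noise_diff \<K> \<epsilon>) z x m0 (q m0)"
  shows
    "let Y = (\<lambda>\<omega>. f + \<epsilon> \<omega>);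
         \<phi>target = K *v f;
         \<phi> = (\<lambda>\<omega> m. \<K> m *v Y \<omega>);
         b = bias_diff \<K> f;
         p = noise_power \<Omega> \<K> \<epsilon>;
         mstar = oracle_model \<M> \<beta> b p;
         \<zz> = critical_value z q p x \<beta>;
         mhat = (\<lambda>\<omega>. sma_selector \<M> (\<phi> \<omega>) \<zz>);
         \<phi>hat = (\<lambda>\<omega>. \<phi> \<omega> (mhat \<omega>))
     in \<P>(\<omega> in \<Omega>. \<not> accepted \<M> (\<phi> \<omega>) \<zz> mstar) \<le> exp (- x) \<and>
        (\<forall>Mc. Mc \<subseteq> models_below \<M> mstar \<and>
               (\<forall>m \<in> Mc. norm (b mstar m) > \<zz> mstar m + z mstar m (x + ln (real (card Mc)))) \<longrightarrow>
           (let zbar = max_or_zero (\<zz> mstar ` (models_below \<M> mstar - Mc))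
            in \<P>(\<omega> in \<Omega>. mhat \<omega> \<in> Mc) \<le> exp (- x) \<and>
               \<P>(\<omega> in \<Omega>. norm (\<phi>hat \<omega> - \<phi> \<omega> mstar) > zbar) \<le> 2 * exp (- x) \<and>
               \<P>(\<omega> in \<Omega>. norm (\<phi>hat \<omega> - \<phi>target) \<le> norm (\<phi> \<omega> mstar - \<phi>target) + zbar)
                 \<ge> 1 - 2 * exp (- x)))"
proof -
  interpret prob_space \<Omega> by (rule prob)
  define \<phi> where "\<phi> = (\<lambda>\<omega> m. \<K> m *v (f + \<epsilon> \<omega>))"
  define p where "p = noise_power \<Omega> \<K> \<epsilon>"
  define m1 where "m1 = oracle_model \<M> \<beta> (bias_diff \<K> f) p"
  define \<zz> where "\<zz> = critical_value z q p x \<beta>"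
  define mhat where "mhat = (\<lambda>\<omega>. sma_selector \<M> (\<phi> \<omega>) \<zz>)"
  have [measurable]: "\<epsilon> \<in> borel_measurable \<Omega>"
    using indep by (intro borel_measurable_vec_components) (auto simp: indep_vars_def)
  have \<phi>_meas [measurable]: "(\<lambda>\<omega>. \<phi> \<omega> m) \<in> borel_measurable \<Omega>" for m
    unfolding \<phi>_def by measurable
  have m1: "m1 \<in> \<M>"
    using oracle_model_mem[OF models(1,2)] unfolding m1_def by blast
  have below: "m \<in> \<M> \<and> m1 \<in> models_above \<M> m" if "m \<in> models_below \<M> m1" for m
    using that m1 by (simp add: models_below_def models_above_def)
  have nonneg: "0 \<le> \<zz> m1 m" if "m \<in> models_below \<M> m1" for m
    unfolding \<zz>_def p_def
  proof (rule critical_value_nonneg[OF prob beta_nonneg])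
    show "m1 \<in> models_above \<M> m"
      using below[OF that] ..
    then show "multiplicity_correction \<Omega> \<M> (noise_diff \<K> \<epsilon>) z x m (q m)"
      using below[OF that] by (intro mult) auto
  qed (use below[OF that] tail in auto)
  have rejected: "\<P>(\<omega> in \<Omega>. \<not> accepted \<M> (\<phi> \<omega>) \<zz> m1) \<le> exp (- x)"
    unfolding \<phi>_def \<zz>_def
  proof (rule prob_oracle_rejected[OF prob _ models(1)])
    show "norm (bias_diff \<K> f m m1) \<le> \<beta> * sqrt (p m m1)" if "m \<in> models_above \<M> m1" for m
      using oracle_model_bias_le[OF models(1,2) beta_nonneg] that unfolding m1_def by blast
  qed (use mult m1 in auto)
  have main: "\<P>(\<omega> in \<Omega>. mhat \<omega> \<in> Mc) \<le> exp (- x) \<and>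
      \<P>(\<omega> in \<Omega>. norm (\<phi> \<omega> (mhat \<omega>) - \<phi> \<omega> m1) > zbar) \<le> 2 * exp (- x) \<and>
      \<P>(\<omega> in \<Omega>. norm (\<phi> \<omega> (mhat \<omega>) - K *v f) \<le> norm (\<phi> \<omega> m1 - K *v f) + zbar)
        \<ge> 1 - 2 * exp (- x)"
    if Mc: "Mc \<subseteq> models_below \<M> m1"
      and bias: "\<And>m. m \<in> Mc \<Longrightarrow>
        norm (bias_diff \<K> f m1 m) > \<zz> m1 m + z m1 m (x + ln (real (card Mc)))"
      and zbar: "zbar = max_or_zero (\<zz> m1 ` (models_below \<M> m1 - Mc))"
    for Mc zbar
  proof -
    let ?R = "{\<omega> \<in> space \<Omega>. \<not> accepted \<M> (\<phi> \<omega>) \<zz> m1}"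
    let ?S = "{\<omega> \<in> space \<Omega>. mhat \<omega> \<in> Mc}"
    let ?A = "{\<omega> \<in> space \<Omega>. \<exists>m \<in> Mc. accepted \<M> (\<phi> \<omega>) \<zz> m}"
    let ?F = "{\<omega> \<in> space \<Omega>. norm (\<phi> \<omega> (mhat \<omega>) - \<phi> \<omega> m1) > zbar}"
    let ?G = "{\<omega> \<in> space \<Omega>. norm (\<phi> \<omega> (mhat \<omega>) - K *v f) \<le> norm (\<phi> \<omega> m1 - K *v f) + zbar}"
    have fin: "finite Mc"
      using Mc models(1) by (auto simp: models_below_def intro: finite_subset)
    have [measurable]: "Measurable.pred \<Omega> (\<lambda>\<omega>. accepted \<M> (\<phi> \<omega>) \<zz> m)" for m
      using models(1) \<phi>_meas by (rule measurable_accepted)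
    have R: "?R \<in> sets \<Omega>" and A: "?A \<in> sets \<Omega>"
      using fin by measurable
    have S: "?S \<in> sets \<Omega>"
      unfolding pred_def[symmetric] mhat_def
      by (rule measurable_pred_sma_selector[OF models(1,2) \<phi>_meas]) simp
    have F: "?F \<in> sets \<Omega>"
      unfolding pred_def[symmetric] mhat_def
      by (rule measurable_pred_sma_selector[OF models(1,2) \<phi>_meas]) measurable
    have G: "?G \<in> sets \<Omega>"
      unfolding pred_def[symmetric] mhat_def
      by (rule measurable_pred_sma_selector[OF models(1,2) \<phi>_meas]) measurable
    have "prob ?S \<le> prob ?A"
      using A sma_selector_mem[OF models(1,2)] unfolding mhat_def
      by (intro finite_measure_mono) auto
    also have "prob ?A \<le> exp (- x)"
      unfolding \<phi>_def
    proof (rule prob_biased_accepted[OF prob _ fin x_pos])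
      show "m1 \<in> models_above \<M> m"
        and "tail_function \<Omega> (\<lambda>\<omega>. norm (noise_diff \<K> \<epsilon> m1 m \<omega>)) (z m1 m)" if "m \<in> Mc" for m
        using below[of m] Mc that tail by blast+
    qed (use bias in auto)
    finally have selected: "prob ?S \<le> exp (- x)" .
    have "norm (\<phi> \<omega> (mhat \<omega>) - \<phi> \<omega> m1) \<le> zbar"
      if "accepted \<M> (\<phi> \<omega>) \<zz> m1" "mhat \<omega> \<notin> Mc" for \<omega>
      using selected_close_to_oracle[OF models(1,2) m1 that(1) _ nonneg] that(2)
      unfolding mhat_def zbar by blast
    then have "?F \<subseteq> ?R \<union> ?S"
      by (auto simp: not_le[symmetric])
    then have "prob ?F \<le> prob (?R \<union> ?S)"
      using R S by (intro finite_measure_mono) auto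
    also have "\<dots> \<le> prob ?R + prob ?S"
      using R S by (rule measure_Un_le)
    finally have far: "prob ?F \<le> 2 * exp (- x)"
      using rejected selected by linarith
    have "norm (\<phi> \<omega> (mhat \<omega>) - K *v f)
        \<le> norm (\<phi> \<omega> (mhat \<omega>) - \<phi> \<omega> m1) + norm (\<phi> \<omega> m1 - K *v f)" for \<omega>
      using norm_triangle_ineq[of "\<phi> \<omega> (mhat \<omega>) - \<phi> \<omega> m1" "\<phi> \<omega> m1 - K *v f"] by simp
    then have "norm (\<phi> \<omega> (mhat \<omega>) - K *v f) \<le> norm (\<phi> \<omega> m1 - K *v f) + zbar"
      if "norm (\<phi> \<omega> (mhat \<omega>) - \<phi> \<omega> m1) \<le> zbar" for \<omega>
      using that by (smt (verit))
    then have "space \<Omega> - ?F \<subseteq> ?G"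
      by (auto simp: not_less)
    then have "1 - prob ?F \<le> prob ?G"
      using finite_measure_mono[OF _ G] unfolding prob_compl[OF F, symmetric] by blast
    with far selected show ?thesis
      by linarith
  qed
  show ?thesis
    using rejected main[OF _ _ refl]
    unfolding Let_def mhat_def \<zz>_def m1_def p_def \<phi>_def by simp
qed

end
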